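(* For any binary word $w$, $$q^w = \frac12 + \sum_{n=|w|}^{\infty} \frac{\mathbb{P}(\tau^w > n)}{n+1}\left(\frac12 - \rho_n^w\right).$$
   Context: A word is an element of $\{0,1\}^k$ for some integer $k \ge 1$; $|\omega|$ is the length of a word $\omega$ and $|\omega|_1$ its number of $1$s. For a word $w$ and $n\ge1$, $\Omega_n^w$ is the set of words in $\{0,1\}^n$ that do not contain $w$ as a factor (contiguous subword), and $$\rho_n^w = \frac{1}{n|\Omega_n^w|}\sum_{\omega\in\Omega_n^w}|\omega|_1 .$$ Let $(X_n)_{n\ge1}$ be i.i.d. Bernoulli$(1/2)$ random variables with law $\mathbb{P}$ and expectation $\mathbb{E}$. For a word $w$ of length $k$, $\tau^w = \min\{t\ge1 : (X_{t-k+1},\dots,X_t)=w\}$ (first time at which $w$ has occurred; necessarily $\tau^w\ge k$). Let $N(t)=\sum_{s=1}^t X_s$, $Q(t)=N(t)/t$, and $q^w=\mathbb{E}[Q(\tau^w)]$. *)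

theory Defs
  imports "HOL-Probability.Probability" "HOL-Library.Sublist" "HOL-Library.Extended_Nat"
begin

text \<open>Binary words are nonempty lists of booleans, with True for the letter 1 and False for 0.\<close>

definition avoiding :: "bool list \<Rightarrow> nat \<Rightarrow> bool list set" where
  "avoiding w n = {v. length v = n \<and> \<not> sublist w v}"

definition rho :: "bool list \<Rightarrow> nat \<Rightarrow> real" where
  "rho w n = (\<Sum>v\<in>avoiding w n. real (count_list v True)) / (real n * real (card (avoiding w n)))"

text \<open>In the following, X 1, X 2, ... are the random letters; the value X 0 is never used.\<close>

definition occurs_at :: "(nat \<Rightarrow> 'a \<Rightarrow> bool) \<Rightarrow> bool list \<Rightarrow> nat \<Rightarrow> 'a \<Rightarrow> bool" where
  "occurs_at X w t x \<longleftrightarrow>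
     length w \<le> t \<and> map (\<lambda>i. X i x) [t - length w + 1..<t + 1] = w"

text \<open>The infimum of the empty set is \<open>\<infinity>\<close>: the waiting time is infinite if w never occurs.\<close>

definition tau :: "(nat \<Rightarrow> 'a \<Rightarrow> bool) \<Rightarrow> bool list \<Rightarrow> 'a \<Rightarrow> enat" where
  "tau X w x = Inf {enat t | t. 1 \<le> t \<and> occurs_at X w t x}"

definition N :: "(nat \<Rightarrow> 'a \<Rightarrow> bool) \<Rightarrow> nat \<Rightarrow> 'a \<Rightarrow> nat" where
  "N X t x = (\<Sum>s = 1..t. of_bool (X s x))"

definition Q :: "(nat \<Rightarrow> 'a \<Rightarrow> bool) \<Rightarrow> nat \<Rightarrow> 'a \<Rightarrow> real" where
  "Q X t x = real (N X t x) / real t"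

text \<open>The value 0 chosen where the waiting time is infinite is immaterial: for fair i.i.d. letters
  this is a null event.\<close>

definition q :: "'a measure \<Rightarrow> (nat \<Rightarrow> 'a \<Rightarrow> bool) \<Rightarrow> bool list \<Rightarrow> real" where
  "q M X w = integral\<^sup>L M (\<lambda>x. case tau X w x of enat t \<Rightarrow> Q X t x | \<infinity> \<Rightarrow> 0)"

definition fair_letters :: "'a measure \<Rightarrow> (nat \<Rightarrow> 'a \<Rightarrow> bool) \<Rightarrow> bool" where
  "fair_letters M X \<longleftrightarrow>
     prob_space.indep_vars M (\<lambda>_. count_space UNIV) X {1..} \<and>
     (\<forall>n\<ge>1. distr M (count_space UNIV) (X n) = measure_pmf (bernoulli_pmf (1/2)))"

end

theory Submission imports Defs begin

text \<open>Since w cannot occur before time |w|, stopping at min (tau, |w|) gives mean letter density 1/2.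
  Moving the cutoff from n to n + 1 changes the density only where tau > n, and there by
  (X (n + 1) - Q n) / (n + 1); since X (n + 1) is independent of the first n letters, which are
  uniform on the avoiding words, the mean increment is P(tau > n) / (n + 1) * (1/2 - rho n). Finally
  the cutoff can be removed because P(tau > n) tends to 0: among the words of length n + |w|, at most
  a fraction 1 - 2 ^ (-|w|) of the extensions of an avoiding word of length n avoid w.\<close>

section \<open>Finite binary words: suffixes, factors and sums over the last letter\<close>

lemma count_list_map_upt:
  "count_list (map P [1..<Suc n]) True = (\<Sum>s = 1..n. of_bool (P s))"
  by (induction n) auto

text \<open>The right-hand side is the body of \<open>occurs_at\<close>; occurrences of
  \<open>w\<close> can thus be treated as suffixes of initial words.\<close>

lemma suffix_map_upt_iff:
  "suffix w (map f [1..<Suc t]) \<longleftrightarrow> length w \<le> t \<and> map f [t - length w + 1..<t + 1] = w"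
proof -
  have "suffix w v \<longleftrightarrow> length w \<le> length v \<and> drop (length v - length w) v = w" for v :: "'a list"
    by (auto simp: suffix_def) (metis append_take_drop_id)
  then show ?thesis
    by (simp add: drop_map drop_upt del: upt_Suc)
qed

text \<open>A factor is a suffix of the prefix that stops where the factor ends.\<close>

lemma sublist_iff_suffix_take:
  "sublist w v \<longleftrightarrow> (\<exists>t\<le>length v. suffix w (take t v))"
  unfolding sublist_altdef
  by (metis append_eq_conv_conj prefix_def prefix_length_le take_is_prefix)

lemma finite_bool_words: "finite {v :: bool list. length v = n}"
  using finite_lists_length_eq[of "UNIV :: bool set" n] by simp

lemma card_bool_words: "card {v :: bool list. length v = n} = 2 ^ n"
  using card_lists_length_eq[of "UNIV :: bool set" n] by simp

lemma finite_avoiding: "finite (avoiding w n)"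
  by (rule finite_subset[OF _ finite_bool_words[of n]]) (auto simp: avoiding_def)

text \<open>Splitting off the last letter later takes the place of conditioning on the first
  \<open>n\<close> letters.\<close>

lemma sum_bool_words_Suc:
  fixes f :: "bool list \<Rightarrow> 'b::comm_monoid_add"
  shows "(\<Sum>v | length v = Suc n. f v) = (\<Sum>u | length u = n. f (u @ [True]) + f (u @ [False]))"
proof -
  have bij: "bij_betw (\<lambda>(u, b). u @ [b]) ({u. length u = n} \<times> (UNIV :: bool set)) {v. length v = Suc n}"
  proof (rule bij_betwI')
    fix v :: "bool list" assume "v \<in> {v. length v = Suc n}"
    then have "length v = Suc n" by simp
    then have "v = butlast v @ [last v]" "length (butlast v) = n"
      by (auto intro!: append_butlast_last_id[symmetric])
    then show "\<exists>p\<in>{u. length u = n} \<times> UNIV. v = (case p of (u, b) \<Rightarrow> u @ [b])"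
      by (intro bexI[of _ "(butlast v, last v)"]) simp_all
  qed auto
  have "(\<Sum>v | length v = Suc n. f v) = (\<Sum>(u, b)\<in>{u. length u = n} \<times> UNIV. f (u @ [b]))"
    using sum.reindex_bij_betw[OF bij, of f] by (simp add: case_prod_unfold)
  also have "\<dots> = (\<Sum>u | length u = n. \<Sum>b\<in>UNIV. f (u @ [b]))"
    by (simp add: sum.cartesian_product)
  finally show ?thesis
    by (simp add: UNIV_bool add.commute)
qed

lemma sum_count_bool_words:
  "(\<Sum>v | length v = n. real (count_list v True)) = real n * 2 ^ n / 2"
proof (induction n)
  case (Suc n)
  have "(\<Sum>v | length v = Suc n. real (count_list v True))
      = (\<Sum>u | length u = n. 2 * real (count_list u True) + 1)"
    by (simp add: sum_bool_words_Suc)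
  also have "\<dots> = 2 * (\<Sum>u | length u = n. real (count_list u True)) + 2 ^ n"
    by (simp add: sum.distrib card_bool_words sum_distrib_left)
  finally show ?case
    using Suc by (simp add: algebra_simps)
qed simp

section \<open>Counting the words that avoid \<open>w\<close>\<close>

lemma sum_count_avoiding:
  "(\<Sum>v\<in>avoiding w n. real (count_list v True)) = real n * real (card (avoiding w n)) * rho w n"
\<comment> \<open>In these cases \<open>rho\<close> divides by zero and is 0; the count of ones
  vanishes as well.\<close>
proof (cases "n = 0 \<or> avoiding w n = {}")
  case True
  then show ?thesis
  proof
    assume "n = 0"
    then have "count_list v True = 0" if "v \<in> avoiding w n" for v
      using that by (simp add: avoiding_def)
    with \<open>n = 0\<close> show ?thesis by simp
  qed simp
next
  case False
  then show ?thesis by (simp add: rho_def finite_avoiding)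
qed

text \<open>Cut after \<open>n\<close> letters: the front still avoids \<open>w\<close>, and the
  final block may be anything except \<open>w\<close> itself.\<close>

lemma card_avoiding_add_le:
  "card (avoiding w (n + length w)) \<le> card (avoiding w n) * (2 ^ length w - 1)"
proof -
  let ?B = "{v :: bool list. length v = length w} - {w}"
  have "avoiding w (n + length w) \<subseteq> (\<lambda>(u, v). u @ v) ` (avoiding w n \<times> ?B)"
  proof
    fix v assume "v \<in> avoiding w (n + length w)"
    then have v: "length v = n + length w" "\<not> sublist w v" by (auto simp: avoiding_def)
    have "\<not> sublist w (take n v)" "drop n v \<noteq> w"
      using v(2) by (metis sublist_take sublist_order.order.trans) (metis v(2) sublist_drop)
    then have "(take n v, drop n v) \<in> avoiding w n \<times> ?B"
      using v(1) by (simp add: avoiding_def)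
    then show "v \<in> (\<lambda>(u, v). u @ v) ` (avoiding w n \<times> ?B)"
      by (intro image_eqI[where x = "(take n v, drop n v)"]) auto
  qed
  then have "card (avoiding w (n + length w)) \<le> card (avoiding w n \<times> ?B)"
    using finite_avoiding finite_bool_words by (intro surj_card_le) auto
  then show ?thesis
    by (simp add: card_cartesian_product card_bool_words card_Diff_singleton)
qed

lemma avoiding_fraction_tendsto_0:
  assumes "w \<noteq> []"
  shows "(\<lambda>n. real (card (avoiding w n)) / 2 ^ n) \<longlonglongrightarrow> 0"
proof -
  let ?a = "\<lambda>n. real (card (avoiding w n)) / 2 ^ n" and ?k = "length w"
  \<comment> \<open>The proportion of blocks of length \<open>?k\<close> that differ from
    \<open>w\<close>.\<close>
  define r :: real where "r = 1 - 1 / 2 ^ ?k"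
  have r: "0 \<le> r" "r < 1" by (auto simp: r_def)
  have step: "?a (n + ?k) \<le> r * ?a n" for n
  proof -
    have "real (card (avoiding w (n + ?k))) \<le> real (card (avoiding w n) * (2 ^ ?k - 1))"
      using card_avoiding_add_le[of w n] by (rule of_nat_mono)
    also have "\<dots> = real (card (avoiding w n)) * (2 ^ ?k - 1)" by simp
    finally show ?thesis by (simp add: r_def field_simps power_add)
  qed
  have sub: "?a (j * ?k + i) \<le> r ^ j * ?a i" for i j
  proof (induction j)
    case (Suc j)
    have "?a (Suc j * ?k + i) \<le> r * ?a (j * ?k + i)"
      using step[of "j * ?k + i"] by (simp add: ac_simps)
    also have "\<dots> \<le> r * (r ^ j * ?a i)" using Suc r by (intro mult_left_mono)
    finally show ?case by (simp add: mult.assoc)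
  qed simp
  have le1: "?a i \<le> 1" for i
  proof -
    have "card (avoiding w i) \<le> 2 ^ i"
      unfolding card_bool_words[symmetric] by (intro card_mono finite_bool_words) (auto simp: avoiding_def)
    then show ?thesis by (simp add: le_divide_eq numeral_power_le_of_nat_cancel_iff of_nat_le_iff flip: of_nat_power)
  qed
  \<comment> \<open>One factor \<open>r\<close> for each complete block; the remaining
    \<open>n mod ?k\<close> letters are bounded trivially by 1.\<close>
  have bound: "?a n \<le> r ^ (n div ?k)" for n
    using sub[of "n div ?k" "n mod ?k"] mult_left_mono[OF le1[of "n mod ?k"], of "r ^ (n div ?k)"] r
    by simp
  have "filterlim (\<lambda>n. n div ?k) at_top sequentially"
    using assms by (intro filterlim_at_top_div_const_nat) simp
  then have "(\<lambda>n. r ^ (n div ?k)) \<longlonglongrightarrow> 0"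
    using filterlim_compose[OF LIMSEQ_power_zero[of r]] r by auto
  then show ?thesis
    by (rule tendsto_sandwich[OF _ _ tendsto_const, rotated 2]) (auto intro: always_eventually bound)
qed

section \<open>Initial words of the random sequence and the waiting time\<close>

definition word :: "(nat \<Rightarrow> 'a \<Rightarrow> bool) \<Rightarrow> nat \<Rightarrow> 'a \<Rightarrow> bool list" where
  "word X n x = map (\<lambda>i. X i x) [1..<Suc n]"

lemma length_word [simp]: "length (word X n x) = n"
  by (simp add: word_def)

lemma take_word: "t \<le> n \<Longrightarrow> take t (word X n x) = word X t x"
  by (simp add: word_def take_map del: upt_Suc)

lemma Q_eq_word: "Q X n x = real (count_list (word X n x) True) / real n"
  unfolding Q_def N_def word_def count_list_map_upt ..

lemma Q_bounds: "0 \<le> Q X n x" "Q X n x \<le> 1"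
  using count_le_length[of "word X n x" True]
  by (auto simp: Q_eq_word divide_le_eq)

text \<open>Makes survival up to time \<open>n\<close> a property of the first \<open>n\<close>
  letters alone, so that its mean is a finite count.\<close>

lemma tau_gt_iff:
  assumes "w \<noteq> []"
  shows "tau X w x > enat n \<longleftrightarrow> \<not> sublist w (word X n x)"
proof -
  have occ: "occurs_at X w t x \<longleftrightarrow> suffix w (word X t x)" for t
    unfolding occurs_at_def word_def suffix_map_upt_iff ..
  have "tau X w x \<le> enat n \<longleftrightarrow> (\<exists>t\<le>n. 1 \<le> t \<and> occurs_at X w t x)" (is "?L \<longleftrightarrow> ?R")
  proof
    assume ?R
    then obtain t where t: "t \<le> n" "1 \<le> t" "occurs_at X w t x" by blast
    then have "tau X w x \<le> enat t" unfolding tau_def by (intro Inf_lower) auto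
    with t(1) show ?L by (meson enat_ord_simps(1) order_trans)
  next
    assume ?L
    \<comment> \<open>The strict bound by \<open>Suc n\<close> lets \<open>Inf_less_iff\<close>
      produce an actual occurrence time.\<close>
    then have "\<exists>e\<in>{enat t | t. 1 \<le> t \<and> occurs_at X w t x}. e < enat (Suc n)"
      unfolding tau_def Inf_less_iff[symmetric]
      by (meson enat_ord_simps(2) le_less_trans lessI)
    then show ?R by (auto simp: less_Suc_eq_le)
  qed
  \<comment> \<open>The condition \<open>1 \<le> t\<close> is automatic: a nonempty \<open>w\<close>
    is no suffix of the empty word.\<close>
  also have "\<dots> \<longleftrightarrow> (\<exists>t\<le>n. suffix w (word X t x))"
    using assms by (auto simp: occ Suc_le_eq word_def)
  also have "\<dots> \<longleftrightarrow> sublist w (word X n x)"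
    by (auto simp: sublist_iff_suffix_take take_word)
  finally show ?thesis by (simp add: not_le[symmetric])
qed

section \<open>The uniform law of the first letters\<close>

locale fair_coin = prob_space M for M :: "'a measure" +
  fixes X :: "nat \<Rightarrow> 'a \<Rightarrow> bool"
  assumes fair: "fair_letters M X"
begin

lemma indep: "indep_vars (\<lambda>_. count_space UNIV) X {1..}"
  using fair by (simp add: fair_letters_def)

lemma X_measurable: "i \<ge> 1 \<Longrightarrow> X i \<in> M \<rightarrow>\<^sub>M count_space UNIV"
  using indep by (auto simp: indep_vars_def)

lemma prob_X:
  assumes "i \<ge> 1"
  shows "prob (X i -` {b} \<inter> space M) = 1 / 2"
proof -
  have "prob (X i -` {b} \<inter> space M) = measure (distr M (count_space UNIV) (X i)) {b}"
    using X_measurable[OF assms] by (simp add: measure_distr)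
  also have "\<dots> = pmf (bernoulli_pmf (1/2)) b"
    using fair assms by (simp add: fair_letters_def measure_pmf_single)
  finally show ?thesis by (cases b) auto
qed

text \<open>The length is positive because an empty intersection would be the whole type instead of
  \<open>space M\<close>. Letters are numbered from 1 and list positions from 0, hence
  \<open>i - 1\<close>.\<close>

lemma word_vimage:
  assumes "length v = Suc n"
  shows "word X (Suc n) -` {v} \<inter> space M = (\<Inter>i\<in>{1..Suc n}. X i -` {v ! (i - 1)} \<inter> space M)"
proof -
  have "word X (Suc n) x = v \<longleftrightarrow> (\<forall>j\<in>{..<Suc n}. X (Suc j) x = v ! (Suc j - 1))" for x
    using assms by (auto simp: list_eq_iff_nth_eq word_def simp del: upt_Suc)
  then have "word X (Suc n) x = v \<longleftrightarrow> (\<forall>i\<in>{1..Suc n}. X i x = v ! (i - 1))" for x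
    unfolding image_Suc_lessThan[symmetric] by blast
  then show ?thesis by auto
qed

lemma word_vimage_sets: "length v = n \<Longrightarrow> word X n -` {v} \<inter> space M \<in> sets M"
proof (cases n)
  case (Suc m)
  assume "length v = n"
  then show ?thesis
    using X_measurable unfolding Suc
    by (subst word_vimage) (auto simp del: INT_simps INT_extend_simps intro!: sets.finite_INT measurable_sets)
qed (simp add: word_def vimage_def)

text \<open>By independence the event has probability a product of \<open>n\<close> factors
  1/2.\<close>

lemma prob_word: "length v = n \<Longrightarrow> prob (word X n -` {v} \<inter> space M) = 1 / 2 ^ n"
proof (cases n)
  case 0
  assume "length v = n"
  then show ?thesis using 0 by (simp add: word_def prob_space vimage_def)
next
  case (Suc m)
  assume v: "length v = n"
  have "prob (\<Inter>i\<in>{1..n}. X i -` {v ! (i - 1)} \<inter> space M) = (\<Prod>i\<in>{1..n}. prob (X i -` {v ! (i - 1)} \<inter> space M))"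
    using Suc by (intro indep_varsD[OF indep]) auto
  also have "\<dots> = (\<Prod>i\<in>{1..n}. 1 / 2)" by (intro prod.cong) (auto simp: prob_X)
  also have "\<dots> = 1 / 2 ^ n" by (simp add: power_one_over)
  finally show ?thesis using word_vimage[of v m] v Suc by simp
qed

text \<open>On \<open>space M\<close> the integrand is a finite combination of indicators of equally
  likely words. Integrability and value of the later means on survival events both come from
  here.\<close>

lemma has_bochner_integral_word:
  fixes f :: "bool list \<Rightarrow> real"
  shows "has_bochner_integral M (\<lambda>x. f (word X n x)) ((\<Sum>v | length v = n. f v) / 2 ^ n)"
proof -
  have "has_bochner_integral M (\<lambda>x. \<Sum>v | length v = n. f v * indicator (word X n -` {v} \<inter> space M) x)
      (\<Sum>v | length v = n. f v * (1 / 2 ^ n))"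
  proof (intro has_bochner_integral_sum has_bochner_integral_mult_right)
    fix v :: "bool list" assume "v \<in> {v. length v = n}"
    then have v: "length v = n" by simp
    show "has_bochner_integral M (indicator (word X n -` {v} \<inter> space M)) (1 / 2 ^ n :: real)"
      using has_bochner_integral_real_indicator[OF word_vimage_sets[OF v]]
      by (simp add: prob_word[OF v] emeasure_eq_measure)
  qed
  moreover have "(\<Sum>v | length v = n. f v * indicator (word X n -` {v} \<inter> space M) x) = f (word X n x)"
    if "x \<in> space M" for x
  proof -
    have "(\<Sum>v | length v = n. f v * indicator (word X n -` {v} \<inter> space M) x)
        = (\<Sum>v | length v = n. if v = word X n x then f v else 0)"
      using that by (intro sum.cong) (auto simp: indicator_def)
    then show ?thesis by (simp add: finite_bool_words)
  qed
  ultimately show ?thesis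
    by (subst (asm) has_bochner_integral_cong[OF refl _ refl]) (auto simp: sum_divide_distrib)
qed

lemma has_bochner_integral_Q:
  assumes "n \<ge> 1"
  shows "has_bochner_integral M (Q X n) (1 / 2)"
  using has_bochner_integral_word[of "\<lambda>v. real (count_list v True) / real n" n] assms
  by (simp add: Q_eq_word[abs_def] sum_count_bool_words flip: sum_divide_distrib)

section \<open>Means on the event that \<open>w\<close> has not yet occurred\<close>

context
  fixes w :: "bool list"
  assumes w: "w \<noteq> []"
begin

lemma sum_of_bool_avoiding:
  "(\<Sum>v | length v = n. of_bool (\<not> sublist w v) * g v) = (\<Sum>v\<in>avoiding w n. g v)"
  for g :: "bool list \<Rightarrow> real"
  by (rule sum.mono_neutral_cong_right) (auto simp: avoiding_def finite_bool_words)

lemma has_bochner_integral_survival: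
  "has_bochner_integral M (\<lambda>x. of_bool (tau X w x > enat n) * g (word X n x))
    ((\<Sum>v\<in>avoiding w n. g v) / 2 ^ n)"
  for g :: "bool list \<Rightarrow> real"
  using has_bochner_integral_word[of "\<lambda>v. of_bool (\<not> sublist w v) * g v" n]
  unfolding sum_of_bool_avoiding tau_gt_iff[OF w] .

text \<open>Given survival, the first \<open>n\<close> letters are uniform on the avoiding words, so
  \<open>Q X n\<close> has conditional mean \<open>rho w n\<close>.\<close>

lemma has_bochner_integral_Q_survival:
  "has_bochner_integral M (\<lambda>x. of_bool (tau X w x > enat n) * Q X n x)
    (card (avoiding w n) / 2 ^ n * rho w n)"
proof -
  have "(\<Sum>v\<in>avoiding w n. real (count_list v True) / real n) = card (avoiding w n) * rho w n"
  proof (cases "n = 0")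
    case True
    then show ?thesis by (simp add: rho_def)
  next
    case False
    then show ?thesis by (simp add: sum_count_avoiding flip: sum_divide_distrib)
  qed
  then show ?thesis
    using has_bochner_integral_survival[of n "\<lambda>v. real (count_list v True) / real n"]
    by (simp add: Q_eq_word)
qed

text \<open>Given survival up to \<open>n\<close>, the expected number of ones is
  \<open>n * rho w n\<close> so far, plus 1/2 for the next letter.\<close>

lemma has_bochner_integral_Q_Suc_survival:
  "has_bochner_integral M (\<lambda>x. of_bool (tau X w x > enat n) * Q X (Suc n) x)
    (card (avoiding w n) / 2 ^ n * ((real n * rho w n + 1 / 2) / real (Suc n)))"
proof -
  \<comment> \<open>Avoidance is tested on the first \<open>n\<close> letters only, leaving the last
    letter free.\<close>
  let ?f = "\<lambda>v. of_bool (\<not> sublist w (take n v)) * (real (count_list v True) / real (Suc n))"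
  have "(\<Sum>v | length v = Suc n. ?f v)
      = (\<Sum>u | length u = n. of_bool (\<not> sublist w u) * ((2 * real (count_list u True) + 1) / real (Suc n)))"
    unfolding sum_bool_words_Suc by (intro sum.cong) (auto simp: add_divide_distrib)
  also have "\<dots> = (2 * (\<Sum>u\<in>avoiding w n. real (count_list u True)) + card (avoiding w n)) / real (Suc n)"
    unfolding sum_of_bool_avoiding by (simp add: sum.distrib sum_distrib_left flip: sum_divide_distrib)
  \<comment> \<open>The factor 2 counts the two extensions and cancels against
    \<open>2 ^ Suc n\<close>.\<close>
  also have "\<dots> = 2 * (card (avoiding w n) * ((real n * rho w n + 1 / 2) / real (Suc n)))"
    unfolding sum_count_avoiding by (simp add: field_simps)
  finally have "(\<Sum>v | length v = Suc n. ?f v) / 2 ^ Suc n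
      = card (avoiding w n) / 2 ^ n * ((real n * rho w n + 1 / 2) / real (Suc n))"
    by (simp only: power_Suc mult_divide_mult_cancel_left_if times_divide_eq_left) simp
  then show ?thesis
    using has_bochner_integral_word[of ?f "Suc n"]
    by (simp add: tau_gt_iff[OF w] Q_eq_word take_word del: of_nat_Suc)
qed

lemma prob_tau_gt: "prob {x \<in> space M. tau X w x > enat n} = card (avoiding w n) / 2 ^ n"
proof -
  have "has_bochner_integral M (\<lambda>x. of_bool (tau X w x > enat n)) (card (avoiding w n) / 2 ^ n)"
    using has_bochner_integral_survival[of n "\<lambda>_. 1"] by simp
  then have "integral\<^sup>L M (\<lambda>x. of_bool (tau X w x > enat n)) = card (avoiding w n) / 2 ^ n"
    by (rule has_bochner_integral_integral_eq)
  also have "integral\<^sup>L M (\<lambda>x. of_bool (tau X w x > enat n))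
      = integral\<^sup>L M (indicator {x \<in> space M. tau X w x > enat n} :: 'a \<Rightarrow> real)"
    by (intro Bochner_Integration.integral_cong) (auto simp: indicator_def)
  finally show ?thesis by (simp add: Int_def conj_commute)
qed

section \<open>Truncating the waiting time and passing to the limit\<close>

definition Q_tau :: "'a \<Rightarrow> real" where
  "Q_tau x = (case tau X w x of enat t \<Rightarrow> Q X t x | \<infinity> \<Rightarrow> 0)"

text \<open>This is 0 on survival. The density stopped at the minimum of \<open>tau\<close> and
  \<open>n\<close> exceeds it by \<open>Q X n\<close> on survival, which explains the subtracted
  \<open>rho\<close> term in its mean below.\<close>

definition Q_tau_upto :: "nat \<Rightarrow> 'a \<Rightarrow> real" where
  "Q_tau_upto n x = of_bool (tau X w x \<le> enat n) * Q_tau x"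

lemma tau_ge_length: "tau X w x \<ge> enat (length w)"
  unfolding tau_def by (intro Inf_greatest) (auto simp: occurs_at_def)

text \<open>Since \<open>tau\<close> is at least \<open>length w\<close>, it equals
  \<open>length w\<close> wherever survival fails at that time.\<close>

lemma Q_tau_upto_length:
  "Q_tau_upto (length w) x = Q X (length w) x - of_bool (tau X w x > enat (length w)) * Q X (length w) x"
  using tau_ge_length[of x]
  by (cases "tau X w x") (auto simp: Q_tau_upto_def Q_tau_def)

text \<open>The two survival indicators differ by the indicator of
  \<open>tau = Suc n\<close>.\<close>

lemma Q_tau_upto_Suc:
  "Q_tau_upto (Suc n) x = Q_tau_upto n x + of_bool (tau X w x > enat n) * Q X (Suc n) x
     - of_bool (tau X w x > enat (Suc n)) * Q X (Suc n) x"
  by (cases "tau X w x") (auto simp: Q_tau_upto_def Q_tau_def not_less le_Suc_eq)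

lemma has_bochner_integral_Q_tau_upto:
  "has_bochner_integral M (Q_tau_upto (length w + m))
    (1 / 2 + (\<Sum>i<m. prob {x \<in> space M. tau X w x > enat (length w + i)}
                        / real (length w + i + 1) * (1/2 - rho w (length w + i)))
       - card (avoiding w (length w + m)) / 2 ^ (length w + m) * rho w (length w + m))"
proof (induction m)
  case 0
  have "length w \<ge> 1" using w by (simp add: Suc_le_eq)
  from has_bochner_integral_diff[OF has_bochner_integral_Q[OF this] has_bochner_integral_Q_survival]
  show ?case by (simp add: Q_tau_upto_length[abs_def])
next
  case (Suc m)
  let ?n = "length w + m"
  \<comment> \<open>With \<open>a\<close> the survival probability and \<open>r\<close> the value
    \<open>rho w n\<close>, this splits the new mean into the next term of the series and
    \<open>a * r\<close>, which cancels the correction from the induction hypothesis.\<close>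
  have alg: "a * ((real n * r + 1/2) / real (Suc n)) = a / real (n + 1) * (1/2 - r) + a * r" for a r :: real and n
    by (simp add: field_simps)
  show ?case
    using has_bochner_integral_diff[OF has_bochner_integral_add[OF Suc has_bochner_integral_Q_Suc_survival[of ?n]]
      has_bochner_integral_Q_survival[of "Suc ?n"]]
    unfolding alg by (simp add: Q_tau_upto_Suc[abs_def] prob_tau_gt add_ac)
qed

text \<open>Convergence holds at every point: the sequence is eventually constant for finite
  \<open>tau\<close> and identically 0 otherwise.\<close>

lemma Q_tau_upto_tendsto: "(\<lambda>m. Q_tau_upto (length w + m) x) \<longlonglongrightarrow> Q_tau x"
proof (cases "tau X w x")
  case (enat t)
  have "eventually (\<lambda>m. Q_tau_upto (length w + m) x = Q_tau x) sequentially"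
    using eventually_ge_at_top[of t] by eventually_elim (simp add: Q_tau_upto_def enat)
  then show ?thesis by (rule tendsto_eventually)
next
  case infinity
  then show ?thesis by (simp add: Q_tau_upto_def Q_tau_def)
qed

text \<open>Dominated convergence applies with bound 1, as densities lie between 0 and 1.\<close>

lemma integral_Q_tau_upto_tendsto:
  "(\<lambda>m. integral\<^sup>L M (Q_tau_upto (length w + m))) \<longlonglongrightarrow> q M X w"
proof -
  have meas: "Q_tau_upto (length w + m) \<in> borel_measurable M" for m
    using has_bochner_integral_Q_tau_upto[of m] by (auto dest: borel_measurable_has_bochner_integral)
  have "(\<lambda>m. integral\<^sup>L M (Q_tau_upto (length w + m))) \<longlonglongrightarrow> integral\<^sup>L M Q_tau"
  proof (rule integral_dominated_convergence[where w = "\<lambda>_. 1"])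
    show "Q_tau \<in> borel_measurable M"
      using meas Q_tau_upto_tendsto by (rule borel_measurable_LIMSEQ_real[rotated])
    have "\<bar>Q_tau x\<bar> \<le> 1" for x
      by (auto simp: Q_tau_def Q_bounds split: enat.split)
    then show "AE x in M. norm (Q_tau_upto (length w + m) x) \<le> 1" for m
      by (auto simp: Q_tau_upto_def)
  qed (auto intro: meas Q_tau_upto_tendsto)
  then show ?thesis by (simp add: q_def Q_tau_def[abs_def])
qed

lemma q_sums:
  "(\<lambda>i. prob {x \<in> space M. tau X w x > enat (length w + i)}
        / real (length w + i + 1) * (1/2 - rho w (length w + i))) sums (q M X w - 1/2)"
proof -
  let ?r = "\<lambda>n. card (avoiding w n) / 2 ^ n * rho w n"
  have rho: "0 \<le> rho w n" "rho w n \<le> 1" for n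
  proof -
    show "0 \<le> rho w n" by (simp add: rho_def sum_nonneg)
    have "(\<Sum>v\<in>avoiding w n. real (count_list v True)) \<le> real (card (avoiding w n)) * real n"
      by (rule sum_bounded_above) (auto simp: avoiding_def count_le_length)
    then show "rho w n \<le> 1" by (auto simp: rho_def divide_le_eq_1 mult.commute)
  qed
  \<comment> \<open>As \<open>rho\<close> lies between 0 and 1, the correction is squeezed by the
    vanishing fraction of avoiding words.\<close>
  have "?r \<longlonglongrightarrow> 0"
    by (rule tendsto_sandwich[OF _ _ tendsto_const avoiding_fraction_tendsto_0[OF w]])
      (auto intro!: always_eventually mult_left_le divide_right_mono simp: rho)
  then have r0: "(\<lambda>m. ?r (length w + m)) \<longlonglongrightarrow> 0"
    using LIMSEQ_ignore_initial_segment[of ?r 0 "length w"] by (simp add: add.commute)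
  show ?thesis
    unfolding sums_def
    \<comment> \<open>Removing 1/2 and adding the correction back leaves exactly the partial
      sums.\<close>
    using tendsto_add[OF tendsto_diff[OF integral_Q_tau_upto_tendsto tendsto_const[of "1/2"]] r0]
    by (simp add: has_bochner_integral_integral_eq[OF has_bochner_integral_Q_tau_upto])
qed

end

end

theorem theorem3p8:
  fixes M :: "'a measure" and X :: "nat \<Rightarrow> 'a \<Rightarrow> bool" and w :: "bool list"
  assumes "prob_space M"
    and "fair_letters M X"
    and "w \<noteq> []"
  shows "summable (\<lambda>i. measure M {x \<in> space M. tau X w x > enat (length w + i)}
                        / real (length w + i + 1) * (1/2 - rho w (length w + i)))
    \<and> q M X w = 1/2 + (\<Sum>i. measure M {x \<in> space M. tau X w x > enat (length w + i)}
                        / real (length w + i + 1) * (1/2 - rho w (length w + i)))"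
proof -
  interpret fair_coin M X
    using assms(1,2) by (simp add: fair_coin_def fair_coin_axioms_def)
  show ?thesis
    using q_sums[OF assms(3)] by (auto simp: sums_iff)
qed

end
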